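(* Let $k_1,k_2,k_3\in\mathbb{Z}$, let $K=P(2k_1+1,2k_2+1,2k_3+1)$, and let $\rho$ be a representation of the knot group of $K$ into ${\rm SL}(2,\mathbb{C})$, given by a triple $X_1,X_2,X_3\in{\rm SL}(2,\mathbb{C})$ as in the context, such that the image $X_1$ of the meridian and the image $L_1$ of the corresponding longitude are both upper-triangular, with upper-left entries $u$ and $w$ respectively; let $t=u+u^{-1}={\rm tr}(X_1)$. If $\chi(\rho)\in\mathcal{X}_3$, then, with $\sigma_1$ and $\lambda$ as in the context, $$(1+w)(u+u^{-1})(\sigma_1+2-2\lambda)=(1-w)(u-u^{-1})(\sigma_1+2-2t^2).$$
   Context: $P(2k_1+1,2k_2+1,2k_3+1)$ is the odd classical pretzel knot. Indices are cyclic mod 3: for $j\in\{1,2,3\}$, $j+$ denotes $j+1$ if $j\in\{1,2\}$ and $1$ if $j=3$; $j-$ denotes $j-1$ if $j\in\{2,3\}$ and $3$ if $j=1$. Representations. The knot group of $K$ is generated by elements $x_1,x_2,x_3$ (conjugate to each other), and a representation $\rho$ into ${\rm SL}(2,\mathbb{C})$ is the same as a triple $X_j=\rho(x_j)\in{\rm SL}(2,\mathbb{C})$, $j=1,2,3$, such that $A_1=A_2=A_3$, where $$Y_j=X_{j+}X_{j-}^{-1},\qquad A_j=Y_j^{k_j}X_{j+}Y_j^{-k_j}X_{j-}.$$ The $X_j$ are then conjugate to each other; $t$ denotes their common trace. The meridian is $\mathfrak{m}=x_1$, and the image under $\rho$ of the corresponding longitude is $$L_1=Y_3^{-k_3}Y_1^{k_1+1}Y_2^{-k_2}Y_3^{k_3+1}Y_1^{-k_1}Y_2^{k_2+1}.$$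 Notation. For $s\in\mathbb{C}$ and $k\in\mathbb{Z}$, choose $a$ with $a+a^{-1}=s$ and put $\omega_k(s)=(a^k-a^{-k})/(a-a^{-1})$ if $a\notin\{\pm1\}$, and $\omega_k(s)=ka^{k-1}$ if $a\in\{\pm1\}$ (independent of the choice of $a$). Put $s_j={\rm tr}(Y_j)$, $\beta_j=\omega_{k_j}(s_j)$, $\gamma_j=\omega_{k_j+1}(s_j)$, $r={\rm tr}(X_1X_2X_3)$, $\tau=t^3+t-r$, $\sigma_1=s_1+s_2+s_3$, $\sigma_2=s_1s_2+s_2s_3+s_3s_1$, $\sigma_3=s_1s_2s_3$, $\delta=4+\sigma_3+2\sigma_2-\sigma_1^2$. The set $\mathcal{X}_3$. The character $\chi(\rho)$ of an irreducible $\rho$ (equivalently, $X_1,X_2,X_3$ have no common eigenvector) is identified with $(t,s_1,s_2,s_3,\tau)\in\mathbb{C}^5$. The condition $\chi(\rho)\in\mathcal{X}_3$ means that $\rho$ is irreducible, $t\neq0$, and, with $\lambda=\tau/t$, $$\sigma_1+2-2\lambda\neq0,\qquad t^2\big(\lambda^2-(\sigma_1+2)\lambda+(\sigma_2+4)\big)=\delta,$$ $$(\lambda-2-s_j)\gamma_j=(\sigma_1-s_j-\lambda)\beta_j,\qquad j=1,2,3.$$ *)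

theory Defs
  imports "HOL-Analysis.Analysis"
begin

text \<open>
  The cyclic indices 1, 2, 3 are the elements of the numeral type \<^typ>\<open>3\<close>, in which
  arithmetic is modulo 3 (and 3 = 0): the successor j+ is \<^term>\<open>j + 1\<close>, the predecessor j-
  is \<^term>\<open>j - 1\<close>. A triple is a function on \<^typ>\<open>3\<close>.
\<close>

definition SL2C :: "(complex^2^2) set" where
  "SL2C = {A. det A = 1}"

text \<open>
  Integer powers with respect to the matrix product \<^term>\<open>(**)\<close>; the library's \<^term>\<open>(*)\<close> on
  \<^typ>\<open>complex^2^2\<close> is the componentwise product, so its power operations do not apply.
\<close>

definition mat_powi :: "complex^2^2 \<Rightarrow> int \<Rightarrow> complex^2^2" where
  "mat_powi A n =
     (if n \<ge> 0 then (((**) A) ^^ nat n) (mat 1)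
      else (((**) (matrix_inv A)) ^^ nat (- n)) (mat 1))"

definition upper_triangular2 :: "complex^2^2 \<Rightarrow> bool" where
  "upper_triangular2 A \<longleftrightarrow> A $ 2 $ 1 = 0"

definition Ymat :: "(3 \<Rightarrow> complex^2^2) \<Rightarrow> 3 \<Rightarrow> complex^2^2" where
  "Ymat X j = X (j + 1) ** matrix_inv (X (j - 1))"

definition Amat :: "(3 \<Rightarrow> int) \<Rightarrow> (3 \<Rightarrow> complex^2^2) \<Rightarrow> 3 \<Rightarrow> complex^2^2" where
  "Amat k X j =
     mat_powi (Ymat X j) (k j) ** X (j + 1) ** mat_powi (Ymat X j) (- k j) ** X (j - 1)"

text \<open>
  Representations into SL(2,C) of the knot group of the pretzel knot
  P(2 k 1 + 1, 2 k 2 + 1, 2 k 3 + 1), given by the images \<^term>\<open>X j\<close> of the generators.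
  The relations imply that the \<^term>\<open>X j\<close> are conjugate to each other, since \<^term>\<open>Amat k X j\<close>
  also equals \<^term>\<open>mat_powi (Ymat X j) (k j + 1) ** X (j - 1) ** mat_powi (Ymat X j) (- (k j + 1)) ** X (j + 1)\<close>.
\<close>

definition pretzel_rep :: "(3 \<Rightarrow> int) \<Rightarrow> (3 \<Rightarrow> complex^2^2) \<Rightarrow> bool" where
  "pretzel_rep k X \<longleftrightarrow>
     (\<forall>j. X j \<in> SL2C) \<and> Amat k X 1 = Amat k X 2 \<and> Amat k X 2 = Amat k X 3"

definition longitude :: "(3 \<Rightarrow> int) \<Rightarrow> (3 \<Rightarrow> complex^2^2) \<Rightarrow> complex^2^2" where
  "longitude k X =
     mat_powi (Ymat X 3) (- k 3) ** mat_powi (Ymat X 1) (k 1 + 1) **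
     mat_powi (Ymat X 2) (- k 2) ** mat_powi (Ymat X 3) (k 3 + 1) **
     mat_powi (Ymat X 1) (- k 1) ** mat_powi (Ymat X 2) (k 2 + 1)"

text \<open>
  The value does not depend on the choice of \<open>a\<close>. The condition \<open>a \<noteq> 0\<close> is needed because
  \<^term>\<open>inverse 0 = (0::complex)\<close>.
\<close>

definition omega :: "int \<Rightarrow> complex \<Rightarrow> complex" where
  "omega n s =
     (let a = (SOME a. a \<noteq> 0 \<and> a + inverse a = s) in
      if a \<noteq> 1 \<and> a \<noteq> - 1 then (a powi n - a powi (- n)) / (a - inverse a)
      else of_int n * a powi (n - 1))"

definition tr_t :: "(3 \<Rightarrow> complex^2^2) \<Rightarrow> complex" where
  "tr_t X = trace (X 1)"

definition tr_s :: "(3 \<Rightarrow> complex^2^2) \<Rightarrow> 3 \<Rightarrow> complex" where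
  "tr_s X j = trace (Ymat X j)"

definition tr_r :: "(3 \<Rightarrow> complex^2^2) \<Rightarrow> complex" where
  "tr_r X = trace (X 1 ** X 2 ** X 3)"

definition tr_tau :: "(3 \<Rightarrow> complex^2^2) \<Rightarrow> complex" where
  "tr_tau X = (tr_t X) ^ 3 + tr_t X - tr_r X"

definition tr_lambda :: "(3 \<Rightarrow> complex^2^2) \<Rightarrow> complex" where
  "tr_lambda X = tr_tau X / tr_t X"

definition sigma1 :: "(3 \<Rightarrow> complex) \<Rightarrow> complex" where
  "sigma1 s = s 1 + s 2 + s 3"

definition sigma2 :: "(3 \<Rightarrow> complex) \<Rightarrow> complex" where
  "sigma2 s = s 1 * s 2 + s 2 * s 3 + s 3 * s 1"

definition sigma3 :: "(3 \<Rightarrow> complex) \<Rightarrow> complex" where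
  "sigma3 s = s 1 * s 2 * s 3"

definition delta :: "(3 \<Rightarrow> complex) \<Rightarrow> complex" where
  "delta s = 4 + sigma3 s + 2 * sigma2 s - (sigma1 s)^2"

definition irreducible_triple :: "(3 \<Rightarrow> complex^2^2) \<Rightarrow> bool" where
  "irreducible_triple X \<longleftrightarrow>
     \<not> (\<exists>v. v \<noteq> 0 \<and> (\<forall>j. \<exists>c. X j *v v = c *s v))"

text \<open>
  The condition that the character of the representation given by \<^term>\<open>X\<close> lies in the set
  \<open>\<X>\<^sub>3\<close>; here \<open>\<beta>\<^sub>j\<close> and \<open>\<gamma>\<^sub>j\<close> are \<^term>\<open>omega (k j) (tr_s X j)\<close> and
  \<^term>\<open>omega (k j + 1) (tr_s X j)\<close>.
\<close>

definition character_in_X3 :: "(3 \<Rightarrow> int) \<Rightarrow> (3 \<Rightarrow> complex^2^2) \<Rightarrow> bool" where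
  "character_in_X3 k X \<longleftrightarrow>
     (let t = tr_t X; s = tr_s X; l = tr_lambda X in
      irreducible_triple X \<and> t \<noteq> 0 \<and>
      sigma1 s + 2 - 2 * l \<noteq> 0 \<and>
      t^2 * (l^2 - (sigma1 s + 2) * l + (sigma2 s + 4)) = delta s \<and>
      (\<forall>j. (l - 2 - s j) * omega (k j + 1) (s j) =
            (sigma1 s - s j - l) * omega (k j) (s j)))"

end

theory Submission
  imports Defs
begin

text \<open>
  Write \<open>A\<close>, \<open>B\<close>, \<open>C\<close> for the images of the three generators and \<open>Y\<^sub>1 = B C\<^sup>-\<^sup>1\<close>, \<open>Y\<^sub>2 = C A\<^sup>-\<^sup>1\<close>,
  \<open>Y\<^sub>3 = A B\<^sup>-\<^sup>1\<close>. The relations of the knot group say that \<open>T\<^sub>1 = Y\<^sub>1^(-k\<^sub>1) Y\<^sub>2^(k\<^sub>2+1)\<close> satisfies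
  \<open>B T\<^sub>1 = T\<^sub>1 A\<close>, and cyclically \<open>C T\<^sub>2 = T\<^sub>2 B\<close> and \<open>A T\<^sub>3 = T\<^sub>3 C\<close>; the longitude is \<open>T\<^sub>3 T\<^sub>2 T\<^sub>1\<close>.

  Two elements of SL(2,C) with common trace \<open>t\<close> are intertwined by \<open>A + B - t I\<close>, and if
  \<open>tr (A B) \<noteq> 2\<close>, then every intertwiner is \<open>A + B - t I\<close> times some \<open>x A + y I\<close>
  (\<open>intertwiner_form\<close>). So \<open>w\<close> is the product of the three numbers \<open>x u + y\<close> and of the upper-left
  entry of the product of the three sums; the latter is a polynomial in \<open>u\<^sup>-\<^sup>1\<close> and in the traces
  (\<open>entry_of_sums\<close>). The numbers \<open>x u + y\<close> are found from the trace of \<open>(A - u\<^sup>-\<^sup>1 I) T\<^sub>1\<close>.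

  By Cayley-Hamilton, \<open>Y\<^sub>j^(k\<^sub>j+1) = \<gamma>\<^sub>j Y\<^sub>j - \<beta>\<^sub>j I\<close> and \<open>Y\<^sub>j^(-k\<^sub>j) = \<gamma>\<^sub>j I - \<beta>\<^sub>j Y\<^sub>j\<close>. The equations that
  define \<open>\<X>\<^sub>3\<close>, together with \<open>\<sigma>\<^sub>1 + 2 - 2 l \<noteq> 0\<close>, give
  \<open>(\<beta>\<^sub>j, \<gamma>\<^sub>j) = c\<^sub>j (l - 2 - s\<^sub>j, \<sigma>\<^sub>1 - s\<^sub>j - l)\<close>, and the determinant relation combined with Fricke's
  relation gives \<open>c\<^sub>j\<^sup>2 (t\<^sup>2 - 2 - s\<^sub>j) F = -1\<close> with \<open>F = l\<^sup>2 - (\<sigma>\<^sub>1 + 2) l + \<sigma>\<^sub>2 + 4\<close>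
  (\<open>omega_proportional\<close>). In particular \<open>t\<^sup>2 - 2 - s\<^sub>j \<noteq> 0\<close>, which is the condition on \<open>tr (A B)\<close>
  above. The factor \<open>c\<^sub>j\<close> occurs in two of the three \<open>T\<close>'s, so only \<open>c\<^sub>j\<^sup>2\<close> enters \<open>w\<close>.

  The trace of \<open>(A - u\<^sup>-\<^sup>1 I) T\<^sub>1\<close> is \<open>c\<^sub>1 c\<^sub>2\<close> times an expression symmetric in the indices
  (\<open>intertwiner_trace_polynomial\<close>). With \<open>a = \<sigma>\<^sub>1 + 2 - 2 l\<close>, \<open>d = u - u\<^sup>-\<^sup>1\<close> and \<open>e = l - t\<^sup>2\<close>, all this
  collapses to \<open>w (d e + u a) = d e - u\<^sup>-\<^sup>1 a\<close> (\<open>longitude_eigenvalue_relation\<close>), which is equivalent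
  to the assertion because \<open>\<sigma>\<^sub>1 + 2 - 2 t\<^sup>2 = a + 2 e\<close>.
\<close>

section \<open>Two-by-two matrices\<close>

text \<open>
  The matrix \<open>a M + b I\<close>. The scalar \<open>a\<close> is multiplied in entrywise; \<^term>\<open>(*s)\<close> scales a vector
  by an element of its component type, which for a matrix is a row and not a number.
\<close>
definition aff :: "complex \<Rightarrow> complex \<Rightarrow> complex^2^2 \<Rightarrow> complex^2^2" where
  "aff a b M = (\<chi> i j. a * M $ i $ j + (if i = j then b else 0))"

lemma mat2_eq_iff: "M = N \<longleftrightarrow> M$1$1 = N$1$1 \<and> M$1$2 = N$1$2 \<and> M$2$1 = N$2$1 \<and> M$2$2 = N$2$2"
  for M N :: "complex^2^2"
  by (auto simp: vec_eq_iff forall_2)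

lemma mat2_mult_nth: "(M ** N)$i$j = M$i$1 * N$1$j + M$i$2 * N$2$j" for M N :: "complex^2^2"
  by (simp add: matrix_matrix_mult_def sum_2)

lemma trace2: "trace M = M$1$1 + M$2$2" for M :: "complex^2^2"
  by (simp add: trace_def sum_2)

lemma aff_nth: "aff a b M $ i $ j = a * M $ i $ j + (if i = j then b else 0)"
  by (simp add: aff_def)

lemma mat_nth: "mat c $ i $ j = (if i = j then c else 0)" by (simp add: mat_def)

lemmas mat2_simps = mat2_eq_iff mat2_mult_nth trace2 aff_nth mat_nth det_2
  vector_add_component vector_minus_component

lemma adjugate_right: "det M = 1 \<Longrightarrow> M ** aff (-1) (trace M) M = mat 1"
  by (simp add: mat2_simps algebra_simps)

lemma adjugate_left: "det M = 1 \<Longrightarrow> aff (-1) (trace M) M ** M = mat 1"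
  by (simp add: mat2_simps algebra_simps)

lemma matrix_inv_SL2: assumes "det M = 1" shows "matrix_inv M = aff (-1) (trace M) M"
proof -
  have "M ** matrix_inv M = mat 1 \<and> matrix_inv M ** M = mat 1"
    unfolding matrix_inv_def
    by (rule someI[of _ "aff (-1) (trace M) M"])
       (use adjugate_left[OF assms] adjugate_right[OF assms] in blast)
  hence "matrix_inv M ** (M ** aff (-1) (trace M) M) = aff (-1) (trace M) M"
    by (simp add: matrix_mul_assoc)
  thus ?thesis using adjugate_right[OF assms] by simp
qed

lemma SL2_inv:
  fixes M :: "complex^2^2"
  assumes "det M = 1"
  shows "M ** matrix_inv M = mat 1" "matrix_inv M ** M = mat 1"
  by (simp_all add: matrix_inv_SL2 adjugate_left adjugate_right assms)

lemma det_inv_SL2: "det M = 1 \<Longrightarrow> det (matrix_inv M) = 1" for M :: "complex^2^2"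
  by (simp add: matrix_inv_SL2 mat2_simps algebra_simps)

lemma matrix_mult_add_distrib_right: "(L + M) ** N = L ** N + M ** N" for L M N :: "complex^2^2"
  by (simp add: mat2_simps algebra_simps)

section \<open>Integer powers and the functions omega\<close>

lemma ex_add_inverse: "\<exists>a::complex. a \<noteq> 0 \<and> a + inverse a = s"
proof -
  define a where "a = (s + csqrt (s^2 - 4)) / 2"
  have e: "a * (s - a) = 1"
  proof -
    have "4 * (a * (s - a)) = s^2 - (csqrt (s^2 - 4))^2"
      by (simp add: a_def field_simps power2_eq_square)
    thus ?thesis by simp
  qed
  hence "a \<noteq> 0" by auto
  moreover have "inverse a = s - a" using e inverse_unique by blast
  ultimately show ?thesis by (intro exI[of _ a]) simp
qed

text \<open>
  The two branches in the definition of \<^const>\<open>omega\<close>, for the chosen \<open>a\<close>.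
\<close>
lemma omega_cases:
  obtains a :: complex where "a \<noteq> 0" "a + inverse a = s" "a \<noteq> 1" "a \<noteq> -1"
    "\<And>n. omega n s = (a powi n - a powi (- n)) / (a - inverse a)"
  | a :: complex where "a * a = 1" "s = 2 * a"
    "\<And>n. omega n s = of_int n * a powi (n - 1)"
proof -
  define a where "a = (SOME a::complex. a \<noteq> 0 \<and> a + inverse a = s)"
  have a: "a \<noteq> 0" "a + inverse a = s"
    using someI_ex[OF ex_add_inverse[of s]] by (auto simp: a_def)
  have om: "omega n s = (if a \<noteq> 1 \<and> a \<noteq> - 1 then (a powi n - a powi (- n)) / (a - inverse a)
      else of_int n * a powi (n - 1))" for n
    by (simp add: omega_def Let_def a_def)
  show ?thesis
  proof (cases "a \<noteq> 1 \<and> a \<noteq> -1")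
    case True
    thus ?thesis using a that(1)[of a] om by simp
  next
    case False
    hence "a * a = 1" "s = 2 * a" using a by auto
    thus ?thesis using that(2)[of a] False om by presburger
  qed
qed

lemma omega_0: "omega 0 s = 0"
  by (rule omega_cases[of s]) auto

lemma omega_1: "omega 1 s = 1"
proof (rule omega_cases[of s], goal_cases)
  case (1 a)
  have "a - inverse a \<noteq> 0"
  proof
    assume "a - inverse a = 0"
    hence "a * a = 1" using 1(1) by (simp add: field_simps)
    thus False using 1 by (simp add: square_eq_1_iff)
  qed
  thus ?case using 1 by (simp add: power_int_minus)
qed simp

lemma omega_minus: "omega (- n) s = - omega n s"
proof (rule omega_cases[of s], goal_cases)
  case (1 a) thus ?case unfolding 1(5) by (simp add: minus_divide_left)
next
  case (2 a)
  have "a \<noteq> 0" "inverse a = a" using 2(1) by (auto intro: inverse_unique)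
  hence "a powi (- n - 1) = a powi (n - 1)"
    using 2(1) by (simp add: power_int_diff power_int_minus field_simps
        flip: power_int_mult_distrib power_int_inverse)
  thus ?case using 2(3)[of n] 2(3)[of "-n"] by simp
qed

lemma omega_rec: "omega (n + 1) s = s * omega n s - omega (n - 1) s"
proof (rule omega_cases[of s], goal_cases)
  case (1 a)
  have "a powi (n+1) - a powi (-(n+1)) = s * (a powi n - a powi (-n)) - (a powi (n-1) - a powi (-(n-1)))"
    using 1(1) by (simp add: power_int_add power_int_diff power_int_minus field_simps flip: 1(2))
  thus ?case unfolding 1(5) by (simp add: diff_divide_distrib right_diff_distrib)
next
  case (2 a)
  have "a \<noteq> 0" using 2 by auto
  define P where "P = a powi (n - 2)"
  have "a powi (n + 1 - 1) = a * a * P" "a powi (n - 1) = a * P" "a powi (n - 1 - 1) = P"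
    using \<open>a \<noteq> 0\<close> unfolding P_def by (auto simp flip: power_int_add_1' simp: algebra_simps)
  thus ?case unfolding 2(3) unfolding 2(2) using 2(1) by (simp add: algebra_simps)
qed

text \<open>
  The quadratic form \<open>\<gamma>\<^sup>2 + \<beta>\<^sup>2 - s \<beta> \<gamma>\<close> is invariant under the step \<open>(\<beta>, \<gamma>) \<mapsto> (\<gamma>, s \<gamma> - \<beta>)\<close>;
  the equation says that \<open>\<gamma> M - \<beta> I\<close> has determinant 1 when \<open>M\<close> has trace \<open>s\<close> and determinant 1.
\<close>
lemma omega_det: "(omega (n + 1) s)^2 + (omega n s)^2 - s * omega n s * omega (n + 1) s = 1"
proof (induction n rule: int_induct[where k = 0])
  case base thus ?case by (simp add: omega_0 omega_1)
next
  case (step1 n)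
  have "omega (n+1+1) s = s * omega (n+1) s - omega n s" using omega_rec[of "n+1" s] by simp
  thus ?case using step1(2) by algebra
next
  case (step2 n)
  have "omega (n-1) s = s * omega n s - omega (n+1) s" using omega_rec[of n s] by simp
  thus ?case using step2(2) by (simp, algebra)
qed

text \<open>
  The Cayley-Hamilton form of the powers, for all integer exponents.
\<close>
lemma mat_powi_omega:
  assumes "det M = 1"
  shows "mat_powi M n = aff (omega n (trace M)) (- omega (n - 1) (trace M)) M"
proof -
  define s where "s = trace M"
  define Q where "Q n = aff (omega n s) (- omega (n - 1) s) M" for n
  have d: "M$1$1 * M$2$2 - M$1$2 * M$2$1 = 1" using assms by (simp add: det_2)
  have s: "s = M$1$1 + M$2$2" by (simp add: s_def trace2)
  have up: "M ** Q n = Q (n + 1)" for n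
  proof -
    have "omega (n + 1) s = s * omega n s - omega (n - 1) s" by (rule omega_rec)
    thus ?thesis using d unfolding Q_def s mat2_simps by simp algebra
  qed
  have Q0: "Q 0 = mat 1"
    by (simp add: Q_def mat2_simps omega_0 omega_1 omega_minus[of 1, simplified])
  have down: "matrix_inv M ** Q n = Q (n - 1)" for n
    using up[of "n - 1"] adjugate_left[OF assms]
    by (metis diff_add_cancel matrix_inv_SL2[OF assms] matrix_mul_assoc matrix_mul_lid)
  have "(((**) M) ^^ m) (mat 1) = Q (int m)" for m
    by (induction m) (auto simp: Q0 up add.commute)
  moreover have "(((**) (matrix_inv M)) ^^ m) (mat 1) = Q (- int m)" for m
  proof (induction m)
    case 0 show ?case by (simp add: Q0)
  next
    case (Suc m)
    have "- int (Suc m) = - int m - 1" by simp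
    thus ?case using Suc by (simp only: funpow.simps o_apply down)
  qed
  ultimately show ?thesis by (simp add: mat_powi_def flip: s_def Q_def)
qed

lemma mat_powi_Suc: "mat_powi M (n + 1) = M ** mat_powi M n" if d: "det M = 1" for M n
proof -
  have d': "M$1$1 * M$2$2 - M$1$2 * M$2$1 = 1" using d by (simp add: det_2)
  have "omega (n + 1) (trace M) = trace M * omega n (trace M) - omega (n - 1) (trace M)"
    by (rule omega_rec)
  thus ?thesis using d' unfolding mat_powi_omega[OF d] mat2_simps by simp algebra
qed

lemma mat_powi_0: "mat_powi M 0 = mat 1"
  by (simp add: mat_powi_def)

lemma mat_powi_add: "mat_powi M (m + n) = mat_powi M m ** mat_powi M n" if d: "det M = 1"
proof (induction m rule: int_induct[where k = 0])
  case base thus ?case by (simp add: mat_powi_0)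
next
  case (step1 m)
  thus ?case using mat_powi_Suc[OF d, of m] mat_powi_Suc[OF d, of "m + n"]
    by (simp add: algebra_simps matrix_mul_assoc)
next
  case (step2 m)
  have l: "matrix_inv M ** (M ** N) = N" for N :: "complex^2^2"
    by (simp add: matrix_mul_assoc SL2_inv[OF d])
  have "mat_powi M (i - 1) = matrix_inv M ** mat_powi M i" for i
    using mat_powi_Suc[OF d, of "i - 1"] l by simp
  from this[of "m"] this[of "m + n"] step2(2) show ?case
    by (simp add: algebra_simps matrix_mul_assoc)
qed

lemma det_mat_powi: "det (mat_powi M n) = 1" if d: "det M = 1"
proof -
  have e: "M$1$1 * M$2$2 - M$1$2 * M$2$1 = 1" using d by (simp add: det_2)
  have "det (aff x y M) = x^2 + x * y * trace M + y^2" for x y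
  proof -
    have "det (aff x y M) = x^2 * (M$1$1 * M$2$2 - M$1$2 * M$2$1) + x * y * trace M + y^2"
      by (simp add: det_2 aff_nth trace2 algebra_simps power2_eq_square)
    thus ?thesis by (simp add: e)
  qed
  thus ?thesis using omega_det[of "n - 1" "trace M"]
    by (simp add: mat_powi_omega[OF d] algebra_simps)
qed

section \<open>Intertwiners of elements of SL(2,C) with equal trace\<close>

lemma trace_eq_of_intertwiner:
  fixes A B T :: "complex^2^2"
  assumes "B ** T = T ** A" "det T = 1"
  shows "trace A = trace B"
proof -
  have "trace A = trace (matrix_inv T ** (T ** A))"
    by (simp add: matrix_mul_assoc SL2_inv assms)
  also have "\<dots> = trace (B ** T ** matrix_inv T)"
    using assms(1) trace_mul_sym by metis
  also have "\<dots> = trace B"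
    by (metis SL2_inv(1)[OF assms(2)] matrix_mul_assoc matrix_mul_rid)
  finally show ?thesis .
qed

lemma commutant_of_nonscalar:
  fixes M N :: "complex^2^2"
  assumes "M ** N = N ** M" "\<And>c. M \<noteq> mat c"
  obtains a b where "N = aff a b M"
proof -
  have e: "M$1$2 * N$2$1 = N$1$2 * M$2$1" "(M$1$1 - M$2$2) * N$1$2 = M$1$2 * (N$1$1 - N$2$2)"
    "(M$1$1 - M$2$2) * N$2$1 = M$2$1 * (N$1$1 - N$2$2)"
  proof -
    have "M$1$1 * N$1$1 + M$1$2 * N$2$1 = N$1$1 * M$1$1 + N$1$2 * M$2$1"
      and "M$1$1 * N$1$2 + M$1$2 * N$2$2 = N$1$1 * M$1$2 + N$1$2 * M$2$2"
      and "M$2$1 * N$1$1 + M$2$2 * N$2$1 = N$2$1 * M$1$1 + N$2$2 * M$2$1"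
      using assms(1) by (simp_all only: mat2_simps)
    thus "M$1$2 * N$2$1 = N$1$2 * M$2$1" "(M$1$1 - M$2$2) * N$1$2 = M$1$2 * (N$1$1 - N$2$2)"
      "(M$1$1 - M$2$2) * N$2$1 = M$2$1 * (N$1$1 - N$2$2)" by algebra+
  qed
  have "M$1$2 \<noteq> 0 \<or> M$2$1 \<noteq> 0 \<or> M$1$1 - M$2$2 \<noteq> 0"
    using assms(2)[of "M$1$1"] by (auto simp: mat2_simps)
  then obtain a where "N$1$2 = a * M$1$2" "N$2$1 = a * M$2$1"
    "N$1$1 - N$2$2 = a * (M$1$1 - M$2$2)"
  proof (elim disjE)
    assume "M$1$2 \<noteq> 0" thus ?thesis using e by (intro that[of "N$1$2 / M$1$2"]) (auto simp: field_simps)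
  next
    assume "M$2$1 \<noteq> 0" thus ?thesis using e by (intro that[of "N$2$1 / M$2$1"]) (auto simp: field_simps)
  next
    assume "M$1$1 - M$2$2 \<noteq> 0" thus ?thesis using e
      by (intro that[of "(N$1$1 - N$2$2) / (M$1$1 - M$2$2)"]) (auto simp: divide_simps mult.commute)
  qed
  hence "N = aff a (N$1$1 - a * M$1$1) M" by (simp add: mat2_simps algebra_simps)
  thus ?thesis by (rule that)
qed

text \<open>
  If \<open>A\<close> and \<open>B\<close> have determinant 1 and the same trace \<open>t\<close>, then \<open>A + B - t I\<close> intertwines them:
  both sides equal \<open>A B - I\<close>, by the Cayley-Hamilton theorem.
\<close>
lemma sum_intertwines:
  fixes A B :: "complex^2^2"
  assumes d: "det A = 1" "det B = 1" and tr: "trace A = t" "trace B = t"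
  shows "A ** (A + B - mat t) = (A + B - mat t) ** B"
proof -
  have e: "A$1$1 * A$2$2 - A$1$2 * A$2$1 = 1" "B$1$1 * B$2$2 - B$1$2 * B$2$1 = 1"
    "A$2$2 = t - A$1$1" "B$2$2 = t - B$1$1"
    using d tr by (auto simp: det_2 trace2 algebra_simps)
  show ?thesis
    using e(1,2) unfolding mat2_simps by (simp add: e(3,4))
      (intro conjI; (simp add: algebra_simps; fail | algebra))
qed

text \<open>
  Put \<open>D = A + B - t I\<close>. Then \<open>D\<^sup>2\<close> is the scalar \<open>tr (A B) - 2\<close>, so \<open>D\<close> is invertible, and
  for every intertwiner \<open>T\<close> the product \<open>D T\<close> commutes with \<open>A\<close>.
\<close>
lemma intertwiner_form:
  fixes A B T :: "complex^2^2"
  assumes d: "det A = 1" "det B = 1" and tr: "trace A = t" "trace B = t"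
    and T: "B ** T = T ** A" and h: "trace (A ** B) \<noteq> 2"
  obtains a b where "T = (A + B - mat t) ** aff a b A"
proof -
  define D where "D = A + B - mat t"
  define h' where "h' = trace (A ** B) - 2"
  have e: "A$1$1 * A$2$2 - A$1$2 * A$2$1 = 1" "B$1$1 * B$2$2 - B$1$2 * B$2$1 = 1"
    "A$2$2 = t - A$1$1" "B$2$2 = t - B$1$1"
    using d tr by (auto simp: det_2 trace2 algebra_simps)
  have D: "A ** D = D ** B" unfolding D_def by (rule sum_intertwines[OF d tr])
  have DD: "D ** D = mat h'"
    using e(1,2) unfolding D_def h'_def mat2_simps by (simp add: e(3,4))
      (intro conjI; (simp add: algebra_simps; fail | algebra))
  have "A ** (D ** T) = D ** T ** A"
    using D T by (metis matrix_mul_assoc)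
  moreover have "A \<noteq> mat c" for c
  proof
    assume "A = mat c"
    moreover from this have "c * c = 1" "t = 2 * c"
      using e(1,3) by (simp_all add: mat_nth)
    moreover have "trace (mat c ** B) = c * trace B"
      by (simp add: mat2_simps algebra_simps)
    ultimately have "trace (A ** B) = 2" using tr by simp
    thus False using h by simp
  qed
  ultimately obtain a b where ab: "D ** T = aff a b A" using commutant_of_nonscalar by metis
  have "mat h' ** T = D ** aff a b A"
    using ab DD by (metis matrix_mul_assoc)
  moreover have "h' \<noteq> 0" using h by (simp add: h'_def)
  ultimately have "T = D ** aff (a / h') (b / h') A"
    unfolding mat2_simps by (simp add: field_simps)
  thus ?thesis using that unfolding D_def by blast
qed

text \<open>
  On the \<open>u\<close>-eigenspace of \<open>A\<close> the factor \<^term>\<open>aff a b A\<close> acts as \<open>a u + b\<close>; a trace against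
  \<open>A - u\<^sup>-\<^sup>1 I\<close>, whose image lies in that eigenspace, reads this number off.
\<close>
lemma intertwiner_trace:
  fixes A B :: "complex^2^2"
  assumes d: "det A = 1" and tr: "trace A = t" "trace B = t"
    and u: "u \<noteq> 0" "t = u + inverse u"
  shows "trace (aff 1 (- inverse u) A ** ((A + B - mat t) ** aff a b A)) =
    (a * u + b) * (trace (A ** B) - 2)"
proof -
  define v where "v = inverse u"
  have uv: "u * v = 1" "t = u + v" using u by (simp_all add: v_def)
  define D where "D = A + B - mat t"
  have e: "A$1$1 * A$2$2 - A$1$2 * A$2$1 = 1" "A$2$2 = u + v - A$1$1" "B$2$2 = u + v - B$1$1"
    using d tr uv by (auto simp: det_2 trace2 algebra_simps)
  have 1: "aff a b A ** aff 1 (- v) A = mat (a * u + b) ** aff 1 (- v) A"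
    using e(1) uv(1) unfolding mat2_simps by (simp add: e(2))
      (intro conjI; (simp add: algebra_simps; fail | algebra))
  have 2: "trace (aff 1 (- v) A ** D) = trace (A ** B) - 2"
  proof -
    define x where "x = A$1$2 * A$2$1"
    have "x = A$1$1 * (u + v - A$1$1) - 1" using e(1,2) by (simp add: x_def diff_eq_eq eq_diff_eq add.commute)
    thus ?thesis using uv(1) unfolding mat2_simps D_def
      by (simp add: e(2,3) uv(2) algebra_simps flip: x_def) algebra
  qed
  have "trace (aff 1 (- v) A ** (D ** aff a b A)) = trace (aff a b A ** aff 1 (- v) A ** D)"
    by (metis matrix_mul_assoc trace_mul_sym)
  also have "\<dots> = (a * u + b) * trace (aff 1 (- v) A ** D)"
    unfolding 1 by (simp add: mat2_simps algebra_simps)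
  finally have "trace (aff 1 (- v) A ** (D ** aff a b A)) = (a * u + b) * (trace (A ** B) - 2)"
    by (simp only: 2)
  thus ?thesis by (simp only: D_def v_def)
qed

lemma aff_intertwines:
  assumes "B ** D = D ** A"
  shows "aff a b B ** D = D ** aff a b A"
proof -
  have aff: "aff a b M = mat a ** M + mat b" for M
    by (simp add: mat2_simps)
  have comm: "mat c ** D = D ** mat c" for c
    by (simp add: mat2_simps algebra_simps)
  have "mat a ** B ** D = D ** (mat a ** A)"
    using assms comm by (metis matrix_mul_assoc)
  thus ?thesis by (simp add: aff matrix_add_ldistrib matrix_mult_add_distrib_right comm)
qed

text \<open>
  The sums intertwine, so all polynomial factors can be moved to the right, where they become
  polynomials in the upper-triangular matrix \<open>A\<close>.
\<close>
lemma entry_of_intertwiner_product: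
  fixes A B C :: "complex^2^2"
  assumes d: "det A = 1" "det B = 1" "det C = 1"
    and tr: "trace A = t" "trace B = t" "trace C = t"
    and A: "A$2$1 = 0" "A$1$1 = u"
  shows "(((C + A - mat t) ** aff a3 b3 C) ** ((B + C - mat t) ** aff a2 b2 B)
      ** ((A + B - mat t) ** aff a1 b1 A)) $ 1 $ 1 =
    (a1 * u + b1) * (a2 * u + b2) * (a3 * u + b3) *
    ((C + A - mat t) ** (B + C - mat t) ** (A + B - mat t)) $ 1 $ 1"
proof -
  define D12 D23 D31 where D: "D12 = A + B - mat t" "D23 = B + C - mat t" "D31 = C + A - mat t"
  have BD: "aff a b B ** D12 = D12 ** aff a b A" and CD: "aff a b C ** D23 = D23 ** aff a b B"
    for a b
    using sum_intertwines[of B A t] sum_intertwines[of C B t] d tr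
    unfolding D by (auto intro!: aff_intertwines simp: add.commute)
  have "(D31 ** aff a3 b3 C) ** (D23 ** aff a2 b2 B) ** (D12 ** aff a1 b1 A)
    = D31 ** (aff a3 b3 C ** D23) ** (aff a2 b2 B ** D12) ** aff a1 b1 A"
    by (simp add: matrix_mul_assoc)
  also have "\<dots> = D31 ** (D23 ** aff a3 b3 B) ** (D12 ** aff a2 b2 A) ** aff a1 b1 A"
    by (simp only: BD CD)
  also have "\<dots> = D31 ** D23 ** (aff a3 b3 B ** D12) ** aff a2 b2 A ** aff a1 b1 A"
    by (simp add: matrix_mul_assoc)
  also have "\<dots> = D31 ** D23 ** (D12 ** aff a3 b3 A) ** aff a2 b2 A ** aff a1 b1 A"
    by (simp only: BD)
  also have "\<dots> = D31 ** D23 ** D12 ** (aff a3 b3 A ** aff a2 b2 A ** aff a1 b1 A)"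
    by (simp add: matrix_mul_assoc)
  finally show ?thesis unfolding D[symmetric]
    by (simp add: mat2_mult_nth[of "D31 ** D23 ** D12"])
       (simp add: mat2_mult_nth aff_nth A)
qed

text \<open>
  The three intertwiners \<open>A + B - t I\<close>, \<open>B + C - t I\<close> and \<open>C + A - t I\<close> successively carry the first
  basis vector, a \<open>u\<close>-eigenvector of \<open>A\<close>, into the \<open>u\<close>-eigenspaces of \<open>B\<close>, of \<open>C\<close> and of \<open>A\<close>. On
  the \<open>u\<close>-eigenspace of the matrix where it starts, each acts as the matrix where it ends minus
  \<open>v I\<close>. Hence the entry
  is the trace of \<open>(A - v I) (C - v I) (B - v I)\<close>, as \<open>A - v I\<close> has second row 0.
\<close>
lemma entry_of_sums:
  fixes A B C :: "complex^2^2"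
  assumes d: "det B = 1" "det C = 1"
    and tr: "trace A = t" "trace B = t" "trace C = t"
    and A: "A$2$1 = 0" "A$1$1 = u" and u: "u * v = 1" "t = u + v"
  shows "((C + A - mat t) ** (B + C - mat t) ** (A + B - mat t)) $ 1 $ 1 =
    trace (A ** C ** B) - v * (trace (A ** B) + trace (B ** C) + trace (C ** A))
    + 3 * t * v^2 - 2 * v^3"
proof -
  define x b1 b2 b3 c1 c2 c3 where xs: "x = A$1$2" "b1 = B$1$1" "b2 = B$1$2" "b3 = B$2$1"
   "c1 = C$1$1" "c2 = C$1$2" "c3 = C$2$1"
  define w1 w2 where "w1 = b1 - v" "w2 = b3"
  define z1 z2 where "z1 = (c1 - v) * w1 + c2 * w2" "z2 = c3 * w1 + (u - c1) * w2"
  have e: "A$2$2 = v" "B$2$2 = t - b1" "C$2$2 = t - c1"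
    using tr A u by (auto simp: trace2 xs algebra_simps)
  have dB: "b1 * (t - b1) - b2 * b3 = 1" and dC: "c1 * (t - c1) - c2 * c3 = 1"
    using d by (simp_all add: det_2 e flip: xs)
  have W: "b1 * w1 + b2 * w2 = u * w1" "b3 * w1 + (t - b1) * w2 = u * w2"
    using dB u unfolding w1_w2_def by algebra+
  have Z: "c1 * z1 + c2 * z2 = u * z1"
    using dC u unfolding z1_z2_def by algebra
  have "((B + C - mat t) ** (A + B - mat t)) $ 1 $ 1 = (b1 + c1 - t) * w1 + (b2 + c2) * w2"
    using u by (simp add: mat2_simps A w1_w2_def flip: xs)
  also have "\<dots> = z1" using W(1) u unfolding z1_z2_def by algebra
  finally have 1: "((B + C - mat t) ** (A + B - mat t)) $ 1 $ 1 = z1" .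
  have "((B + C - mat t) ** (A + B - mat t)) $ 2 $ 1 = (b3 + c3) * w1 + (t - b1 - c1) * w2"
    using u by (simp add: mat2_simps A e w1_w2_def flip: xs)
  also have "\<dots> = z2" using W(2) u unfolding z1_z2_def by algebra
  finally have 2: "((B + C - mat t) ** (A + B - mat t)) $ 2 $ 1 = z2" .
  have "((C + A - mat t) ** (B + C - mat t) ** (A + B - mat t)) $ 1 $ 1
     = (c1 + u - t) * z1 + (c2 + x) * z2"
    unfolding matrix_mul_assoc[symmetric] mat2_mult_nth[of "C + A - mat t"] 1 2
    by (simp add: mat2_simps A flip: xs)
  also have "\<dots> = (u - v) * z1 + x * z2" using Z u by algebra
  also have "\<dots> = trace (A ** C ** B) - v * (trace (A ** B) + trace (B ** C) + trace (C ** A))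
    + 3 * t * v^2 - 2 * v^3"
    unfolding trace2 mat2_mult_nth A e xs[symmetric] z1_z2_def w1_w2_def using u dB dC by algebra
  finally show ?thesis .
qed

section \<open>Trace identities\<close>

lemma trace_aff_mult3:
  fixes A Y Z :: "complex^2^2"
  shows "trace (aff 1 (- v) A ** (aff a b Y ** aff c d Z)) =
    a * c * (trace (A ** (Y ** Z)) - v * trace (Y ** Z)) + a * d * (trace (A ** Y) - v * trace Y)
    + b * c * (trace (A ** Z) - v * trace Z) + b * d * (trace A - 2 * v)"
  unfolding trace2 mat2_mult_nth aff_nth by (simp add: algebra_simps)

lemma trace_mult_inv:
  fixes A B :: "complex^2^2"
  assumes "det B = 1"
  shows "trace (A ** matrix_inv B) = trace A * trace B - trace (A ** B)"
  unfolding matrix_inv_SL2[OF assms] by (simp add: mat2_simps algebra_simps)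

lemma trace_product_sum:
  fixes A B C :: "complex^2^2"
  shows "trace (A ** B ** C) + trace (A ** C ** B) =
    trace A * trace (B ** C) + trace B * trace (A ** C) + trace C * trace (A ** B)
    - trace A * trace B * trace C"
  unfolding trace2 mat2_mult_nth by (simp add: algebra_simps)

section \<open>Identities in the trace coordinates\<close>

text \<open>
  With \<open>q\<^sub>j = p\<^sub>j + a\<close>, the left-hand side turns out to be \<open>t E - v (2 E + a F)\<close>, which is
  symmetric in the three indices; the last term of the left-hand side is where \<open>p\<^sub>3\<close> comes from.
\<close>
lemma intertwiner_trace_polynomial:
  fixes s1 s2 s3 l t u v :: complex
  defines "a \<equiv> s1 + s2 + s3 + 2 - 2 * l"
    and "p1 \<equiv> l - 2 - s1" and "p2 \<equiv> l - 2 - s2" and "p3 \<equiv> l - 2 - s3"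
    and "q1 \<equiv> s2 + s3 - l" and "q2 \<equiv> s3 + s1 - l"
    and "F \<equiv> l^2 - (s1 + s2 + s3 + 2) * l + (s1 * s2 + s2 * s3 + s3 * s1 + 4)"
  defines "E \<equiv> a^2 + p1 * p2 * p3"
  assumes "u * v = 1" "t = u + v"
  shows "q1 * q2 * (t - v * s2) - q1 * p2 * (t - 2 * v) - p1 * q2 * (t - v * s3)
    + p1 * p2 * (t * (t^2 - s3) - (t^3 + t - l * t) - v * s1) = (u - v) * E - v * a * F"
proof -
  have "q1 * q2 * (t - v * s2) - q1 * p2 * (t - 2 * v) - p1 * q2 * (t - v * s3)
    + p1 * p2 * (t * (t^2 - s3) - (t^3 + t - l * t) - v * s1) = t * E - v * (2 * E + a * F)"
    unfolding E_def F_def a_def p1_def p2_def p3_def q1_def q2_def by algebra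
  thus ?thesis unfolding assms(10) by algebra
qed

text \<open>
  The assumption on \<open>t\<^sup>2 F\<close> is Fricke's relation between the traces of three matrices, with the
  trace of the triple product expressed by \<open>l\<close>. For \<open>Y\<close> of determinant 1 and trace \<open>s\<^sub>1\<close>, the
  conclusion factors the determinant of \<open>q Y - p I\<close>.
\<close>
lemma fricke_det_factor:
  fixes s1 s2 s3 l t :: complex
  defines "\<sigma> \<equiv> s1 + s2 + s3"
  defines "p \<equiv> l - 2 - s1" and "q \<equiv> \<sigma> - s1 - l"
    and "F \<equiv> l^2 - (\<sigma> + 2) * l + (s1 * s2 + s2 * s3 + s3 * s1 + 4)"
  assumes "t^2 * F = 4 + s1 * s2 * s3 + 2 * (s1 * s2 + s2 * s3 + s3 * s1) - \<sigma>^2"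
  shows "p^2 + q^2 - s1 * p * q = (s1 + 2 - t^2) * F"
  using assms(5) unfolding F_def p_def q_def \<sigma>_def by algebra

text \<open>
  The linear equation on \<open>(\<beta>, \<gamma>)\<close> has coefficients that cannot both vanish, since their difference
  is \<open>2 l - 2 - \<sigma>\<close>. It therefore determines \<open>(\<beta>, \<gamma>)\<close> up to a scalar \<open>c\<close>, and the determinant
  relation of \<^const>\<open>omega\<close> determines \<open>c\<^sup>2\<close>.
\<close>
lemma omega_proportional:
  fixes s1 s2 s3 l t :: complex
  defines "\<sigma> \<equiv> s1 + s2 + s3"
  defines "F \<equiv> l^2 - (\<sigma> + 2) * l + (s1 * s2 + s2 * s3 + s3 * s1 + 4)"
  assumes eq: "(l - 2 - s1) * omega (k + 1) s1 = (\<sigma> - s1 - l) * omega k s1"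
    and nz: "\<sigma> + 2 - 2 * l \<noteq> 0"
    and fricke: "t^2 * F = 4 + s1 * s2 * s3 + 2 * (s1 * s2 + s2 * s3 + s3 * s1) - \<sigma>^2"
  obtains c where "omega k s1 = c * (l - 2 - s1)" "omega (k + 1) s1 = c * (s2 + s3 - l)"
    "c^2 * ((t^2 - 2 - s1) * F) = -1"
proof -
  have q: "\<sigma> - s1 - l = s2 + s3 - l" by (simp add: \<sigma>_def)
  have "l - 2 - s1 \<noteq> 0 \<or> s2 + s3 - l \<noteq> 0"
    using nz by (auto simp: \<sigma>_def algebra_simps)
  then obtain c where c: "omega k s1 = c * (l - 2 - s1)" "omega (k + 1) s1 = c * (s2 + s3 - l)"
  proof (elim disjE)
    assume "l - 2 - s1 \<noteq> 0"
    thus ?thesis using eq unfolding q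
      by (intro that[of "omega k s1 / (l - 2 - s1)"]) (auto simp: divide_simps mult.commute)
  next
    assume "s2 + s3 - l \<noteq> 0"
    thus ?thesis using eq unfolding q
      by (intro that[of "omega (k + 1) s1 / (s2 + s3 - l)"]) (auto simp: divide_simps mult.commute)
  qed
  have "c^2 * ((l - 2 - s1)^2 + (s2 + s3 - l)^2 - s1 * (l - 2 - s1) * (s2 + s3 - l)) = 1"
    using omega_det[of k s1] unfolding c by algebra
  hence "c^2 * ((s1 + 2 - t^2) * F) = 1"
    using fricke_det_factor[of t l s1 s2 s3] fricke unfolding F_def \<sigma>_def by simp
  hence "c^2 * ((t^2 - 2 - s1) * F) = -1" by algebra
  thus ?thesis using that c by blast
qed

text \<open>
  The elimination that ends the proof. Here \<open>g\<^sub>1 g\<^sub>2 g\<^sub>3\<close> and the trace factor give \<open>w\<close>. With \<open>e = E / F\<close>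
  and \<open>d = u - v\<close>, Fricke's relation reads \<open>t\<^sup>2 = l - e\<close>, the product \<open>h\<^sub>1 h\<^sub>2 h\<^sub>3\<close> factors as
  \<open>m m'\<close> with \<open>m = d e - v a\<close> and \<open>m' = d e + u a\<close>, the trace factor is \<open>- m'\<close>, and \<open>n = F m\<close>.
  Everything cancels to \<open>w m' = m\<close>.
\<close>
lemma longitude_eigenvalue_relation:
  fixes s1 s2 s3 l t u v w :: complex
  defines "a \<equiv> s1 + s2 + s3 + 2 - 2 * l"
    and "p1 \<equiv> l - 2 - s1" and "p2 \<equiv> l - 2 - s2" and "p3 \<equiv> l - 2 - s3"
    and "F \<equiv> l^2 - (s1 + s2 + s3 + 2) * l + (s1 * s2 + s2 * s3 + s3 * s1 + 4)"
    and "h1 \<equiv> t^2 - 2 - s1" and "h2 \<equiv> t^2 - 2 - s2" and "h3 \<equiv> t^2 - 2 - s3"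
  defines "E \<equiv> a^2 + p1 * p2 * p3"
  defines "n \<equiv> (u - v) * E - v * a * F"
  assumes uv: "u * v = 1" "t = u + v"
    and fricke: "t^2 * F = 4 + s1 * s2 * s3 + 2 * (s1 * s2 + s2 * s3 + s3 * s1) - (s1 + s2 + s3)^2"
    and c: "c1^2 * (h1 * F) = -1" "c2^2 * (h2 * F) = -1" "c3^2 * (h3 * F) = -1"
    and g: "g1 * h3 = c1 * c2 * n" "g2 * h1 = c2 * c3 * n" "g3 * h2 = c3 * c1 * n"
    and w: "w = g1 * g2 * g3 * (t * (t^2 - 1 - (s1 + s2 + s3) + l)
        - v * (3 * t^2 - (s1 + s2 + s3)) + 3 * t * v^2 - 2 * v^3)"
  shows "(1 + w) * t * a = (1 - w) * (u - v) * (s1 + s2 + s3 + 2 - 2 * t^2)"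
proof -
  have F0: "F \<noteq> 0" using c(1) by auto
  have h0: "h1 \<noteq> 0" "h2 \<noteq> 0" "h3 \<noteq> 0" using c by auto
  define e where "e = E / F"
  have E: "E = e * F" using F0 by (simp add: e_def)
  define m where "m = (u - v) * e - v * a"
  define m' where "m' = (u - v) * e + u * a"
  have n: "n = F * m" unfolding n_def m_def E by algebra
  have "t^2 * F = l * F - E"
    using fricke unfolding E_def F_def a_def p1_def p2_def p3_def by algebra
  hence "F * (t^2 - (l - e)) = 0" unfolding E by algebra
  hence t2: "t^2 = l - e" using F0 by simp
  have hp: "h1 = p1 - e" "h2 = p2 - e" "h3 = p3 - e"
    using t2 by (simp_all add: h1_def h2_def h3_def p1_def p2_def p3_def)
  have Fa: "F = p1*p2 + p2*p3 + p3*p1 + a * (p1 + p2 + p3) + a^2"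
    unfolding F_def a_def p1_def p2_def p3_def by algebra
  have la: "l = a + 4 + p1 + p2 + p3"
    unfolding a_def p1_def p2_def p3_def by algebra
  have d2: "(u - v)^2 = t^2 - 4" using uv by algebra
  have "h1 * h2 * h3 = e * (a + e) * (t^2 - 4) - a^2"
    using E t2 unfolding hp E_def Fa la by algebra
  also have "\<dots> = m * m'"
    using d2 uv unfolding m_def m'_def by algebra
  finally have H: "h1 * h2 * h3 = m * m'" .
  hence m0: "m \<noteq> 0" "m' \<noteq> 0" using h0 by auto
  have kap: "t * (t^2 - 1 - (s1 + s2 + s3) + l)
        - v * (3 * t^2 - (s1 + s2 + s3)) + 3 * t * v^2 - 2 * v^3 = - m'"
  proof -
    have "l = t^2 + e" "s1 + s2 + s3 = a + 2 * t^2 + 2 * e - 2"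
      using t2 by (simp_all add: a_def)
    thus ?thesis using uv unfolding m'_def by algebra
  qed
  define G where "G = g1 * g2 * g3"
  define K where "K = c1^2 * c2^2 * c3^2"
  have Gh: "G * (m * m') = K * F^3 * m^3"
  proof -
    have "G * (h1 * h2 * h3) = (g1 * h3) * (g2 * h1) * (g3 * h2)" by (simp add: G_def)
    also have "\<dots> = K * F^3 * m^3" unfolding g n K_def by algebra
    finally show ?thesis by (simp add: H)
  qed
  have "K * F^3 * (m * m') = (c1^2 * (h1 * F)) * (c2^2 * (h2 * F)) * (c3^2 * (h3 * F))"
    unfolding H[symmetric] K_def by algebra
  hence K: "K * F^3 * (m * m') = -1" by (simp add: c)
  have "G * m' * m' = - m"
  proof -
    have "m^2 * (G * m' * m' + m) = 0" using Gh K by algebra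
    thus ?thesis using m0 by (simp add: eq_neg_iff_add_eq_0)
  qed
  moreover have "w = - G * m'" using w unfolding kap G_def by simp
  ultimately have wm: "w * m' = m" by simp
  have "m' * ((1 + w) * t * a - (1 - w) * (u - v) * (s1 + s2 + s3 + 2 - 2 * t^2)) = 0"
  proof -
    have "s1 + s2 + s3 + 2 - 2 * t^2 = a + 2 * e"
      using t2 by (simp add: a_def)
    thus ?thesis using wm uv unfolding m_def m'_def by algebra
  qed
  thus ?thesis using m0 by simp
qed

section \<open>Intertwiners from the pretzel relations\<close>

text \<open>
  The right-hand side of the relation equals \<open>Z^(m+1) A Z^(-m-1) C\<close>, because \<open>Z A = C\<close>;
  cancelling \<open>C\<close> turns the relation into a conjugation of \<open>A\<close> to \<open>B\<close>.
\<close>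
lemma pretzel_intertwiner:
  fixes A B C :: "complex^2^2"
  defines "Y \<equiv> B ** matrix_inv C" and "Z \<equiv> C ** matrix_inv A"
  assumes d: "det A = 1" "det B = 1" "det C = 1"
    and rel: "mat_powi Y k ** B ** mat_powi Y (- k) ** C =
              mat_powi Z m ** C ** mat_powi Z (- m) ** A"
  defines "T \<equiv> mat_powi Y (- k) ** mat_powi Z (m + 1)"
  shows "B ** T = T ** A"
proof -
  have cancel: "N ** M ** matrix_inv M = N" "N ** matrix_inv M ** M = N"
    if "det M = 1" for M N :: "complex^2^2"
    using SL2_inv[OF that] by (simp_all flip: matrix_mul_assoc)
  have dY: "det Y = 1" and dZ: "det Z = 1"
    using d by (simp_all add: Y_def Z_def det_mul det_inv_SL2)
  have ZA: "Z ** A = C" unfolding Z_def using cancel d by simp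
  have Z1: "mat_powi Z (m + 1) = mat_powi Z m ** Z"
    using mat_powi_add[OF dZ, of m 1] mat_powi_Suc[OF dZ, of 0] by (simp add: mat_powi_0)
  have Z2: "mat_powi Z (- m) = mat_powi Z (- (m + 1)) ** Z"
    using mat_powi_add[OF dZ, of "- (m + 1)" 1] mat_powi_Suc[OF dZ, of 0] by (simp add: mat_powi_0)
  have "mat_powi Z m ** C ** mat_powi Z (- m) ** A
        = mat_powi Z (m + 1) ** A ** mat_powi Z (- (m + 1)) ** C"
    unfolding Z1 Z2 ZA[symmetric] by (simp add: matrix_mul_assoc)
  hence e: "mat_powi Y k ** B ** mat_powi Y (- k) = mat_powi Z (m + 1) ** A ** mat_powi Z (- (m + 1))"
    using rel cancel(1)[OF d(3)] by metis
  have Y': "mat_powi Y (- k) ** mat_powi Y k = mat 1"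
    using mat_powi_add[OF dY, of "-k" k] by (simp add: mat_powi_0)
  have Z': "mat_powi Z (- (m + 1)) ** mat_powi Z (m + 1) = mat 1"
    using mat_powi_add[OF dZ, of "- (m+1)" "m+1"] by (simp add: mat_powi_0)
  have "B ** T = (mat_powi Y (- k) ** mat_powi Y k) ** B ** mat_powi Y (- k) ** mat_powi Z (m + 1)"
    by (simp add: Y' T_def matrix_mul_assoc)
  also have "\<dots> = mat_powi Y (- k) ** (mat_powi Y k ** B ** mat_powi Y (- k)) ** mat_powi Z (m + 1)"
    by (simp add: matrix_mul_assoc)
  also have "\<dots> = T ** A ** (mat_powi Z (- (m + 1)) ** mat_powi Z (m + 1))"
    unfolding e by (simp add: T_def matrix_mul_assoc)
  finally show ?thesis by (simp only: Z' matrix_mul_rid)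
qed

text \<open>
  The trace of \<^term>\<open>aff 1 (- v) A\<close> times the intertwiner, in terms of the trace coordinates. The
  only mixed terms are \<open>Y Z = B A\<^sup>-\<^sup>1\<close>, \<open>A Z = A C A\<^sup>-\<^sup>1\<close>, \<open>A Y Z = A B A\<^sup>-\<^sup>1\<close> and \<open>A Y = A B C\<^sup>-\<^sup>1\<close>.
\<close>
lemma trace_pretzel_intertwiner:
  fixes A B C :: "complex^2^2"
  defines "Y \<equiv> B ** matrix_inv C" and "Z \<equiv> C ** matrix_inv A"
  assumes d: "det A = 1" "det B = 1" "det C = 1"
    and tr: "trace A = t" "trace B = t" "trace C = t"
  shows "trace (aff 1 (- v) A ** (aff (- p1) q1 Y ** aff q2 (- p2) Z)) =
    q1 * q2 * (t - v * trace Z) - q1 * p2 * (t - 2 * v) - p1 * q2 * (t - v * trace (A ** matrix_inv B))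
    + p1 * p2 * (t * (t^2 - trace (A ** matrix_inv B)) - trace (A ** B ** C) - v * trace Y)"
proof -
  have YZ: "Y ** Z = B ** matrix_inv A"
    unfolding Y_def Z_def by (metis SL2_inv(2)[OF d(3)] matrix_mul_assoc matrix_mul_rid)
  have conj: "trace (A ** (M ** matrix_inv A)) = trace M" for M :: "complex^2^2"
    by (metis SL2_inv(2)[OF d(1)] matrix_mul_assoc matrix_mul_rid trace_mul_sym)
  have 1: "trace (A ** (Y ** Z)) = t" unfolding YZ using conj[of B] tr by simp
  have AZ: "trace (A ** Z) = t" unfolding Z_def using conj[of C] tr by simp
  have 2: "trace (Y ** Z) = trace (A ** matrix_inv B)"
    unfolding YZ trace_mult_inv[OF d(1)] trace_mult_inv[OF d(2)]
    by (simp add: mult.commute trace_mul_sym[of B A])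
  have "trace (A ** Y) = trace (A ** B ** matrix_inv C)"
    by (simp add: Y_def matrix_mul_assoc)
  also have "\<dots> = trace (A ** B) * t - trace (A ** B ** C)"
    by (simp add: trace_mult_inv d tr)
  also have "trace (A ** B) = t^2 - trace (A ** matrix_inv B)"
    unfolding trace_mult_inv[OF d(2)] tr by (simp add: power2_eq_square)
  finally have AY: "trace (A ** Y) = (t^2 - trace (A ** matrix_inv B)) * t - trace (A ** B ** C)" .
  show ?thesis unfolding trace_aff_mult3 1 AZ AY 2 tr by (simp add: algebra_simps)
qed

text \<open>
  The intertwiner \<open>T\<close> is \<open>A + B - t I\<close> times a polynomial in \<open>A\<close>. The value of that polynomial at the
  eigenvalue \<open>u\<close> is given here, up to the factors \<open>c\<^sub>1\<close>, \<open>c\<^sub>2\<close>, by an expression in \<open>E\<close>, \<open>a\<close> and \<open>F\<close>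
  that is the same for all three rotations of the indices.
\<close>
lemma pretzel_intertwiner_eigenvalue:
  fixes A B C :: "complex^2^2" and k m :: int and u v t l :: complex
  defines "Y \<equiv> B ** matrix_inv C" and "Z \<equiv> C ** matrix_inv A"
  defines "T \<equiv> mat_powi Y (- k) ** mat_powi Z (m + 1)"
  assumes d: "det A = 1" "det B = 1" "det C = 1"
    and tr: "trace A = t" "trace B = t" "trace C = t"
    and T: "B ** T = T ** A"
    and s: "s1 = trace Y" "s2 = trace Z" "s3 = trace (A ** matrix_inv B)"
    and r: "trace (A ** B ** C) = t^3 + t - l * t"
    and p: "omega k s1 = c1 * (l - 2 - s1)" "omega (k + 1) s1 = c1 * (s2 + s3 - l)"
      "omega m s2 = c2 * (l - 2 - s2)" "omega (m + 1) s2 = c2 * (s3 + s1 - l)"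
    and uv: "u * v = 1" "t = u + v"
    and h: "t^2 - 2 - s3 \<noteq> 0"
    and defs: "a = s1 + s2 + s3 + 2 - 2 * l"
      "F = l^2 - (s1 + s2 + s3 + 2) * l + (s1 * s2 + s2 * s3 + s3 * s1 + 4)"
      "E = a^2 + (l - 2 - s1) * (l - 2 - s2) * (l - 2 - s3)"
  obtains x y where "T = (A + B - mat t) ** aff x y A"
    "(x * u + y) * (t^2 - 2 - s3) = c1 * c2 * ((u - v) * E - v * a * F)"
proof -
  have dY: "det Y = 1" and dZ: "det Z = 1"
    using d by (simp_all add: Y_def Z_def det_mul det_inv_SL2)
  have Y: "mat_powi Y (- k) = aff (- omega k s1) (omega (k + 1) s1) Y"
  proof -
    have "- k - 1 = - (k + 1)" by simp
    thus ?thesis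
      by (simp only: mat_powi_omega[OF dY] s(1)[symmetric] omega_minus minus_minus)
  qed
  have Z: "mat_powi Z (m + 1) = aff (omega (m + 1) s2) (- omega m s2) Z"
    by (simp add: mat_powi_omega[OF dZ] flip: s)
  have AB: "trace (A ** B) = t^2 - s3"
    unfolding s(3) trace_mult_inv[OF d(2)] tr by (simp add: power2_eq_square)
  have "trace (A ** B) \<noteq> 2"
  proof
    assume "trace (A ** B) = 2"
    hence "t^2 - 2 - s3 = 0" unfolding AB by (simp add: diff_diff_eq diff_eq_eq add.commute)
    with h show False ..
  qed
  then obtain x y where xy: "T = (A + B - mat t) ** aff x y A"
    using intertwiner_form[OF d(1,2) tr(1,2) T] by blast
  have v: "inverse u = v" "u \<noteq> 0" using uv inverse_unique by auto
  have factor: "c1 * Q1 * (c2 * Q2) * a - c1 * Q1 * (c2 * P2) * b - c1 * P1 * (c2 * Q2) * c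
      + c1 * P1 * (c2 * P2) * d = c1 * c2 * (Q1 * Q2 * a - Q1 * P2 * b - P1 * Q2 * c + P1 * P2 * d)"
    for Q1 P1 Q2 P2 a b c d :: complex
    by (simp add: algebra_simps)
  have "(x * u + y) * (t^2 - 2 - s3) = trace (aff 1 (- v) A ** T)"
    using intertwiner_trace[OF d(1) tr(1,2) v(2), of x y] uv unfolding xy v(1) AB
    by (simp add: algebra_simps)
  also have "\<dots> = c1 * c2 * ((s2 + s3 - l) * (s3 + s1 - l) * (t - v * s2)
     - (s2 + s3 - l) * (l - 2 - s2) * (t - 2 * v) - (l - 2 - s1) * (s3 + s1 - l) * (t - v * s3)
     + (l - 2 - s1) * (l - 2 - s2) * (t * (t^2 - s3) - (t^3 + t - l * t) - v * s1))"
    unfolding T_def Y Z trace_pretzel_intertwiner[OF d tr, folded Y_def Z_def]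
    unfolding s[symmetric] r p by (rule factor)
  also have "\<dots> = c1 * c2 * ((u - v) * E - v * a * F)"
    unfolding intertwiner_trace_polynomial[OF uv, of s2 s3 l s1] defs ..
  finally show ?thesis using that xy by blast
qed

section \<open>The eigenvalue of the longitude\<close>

theorem proposition4p1:
  fixes k :: "3 \<Rightarrow> int" and X :: "3 \<Rightarrow> complex^2^2"
    and u w t \<sigma>\<^sub>1 l :: complex
  assumes "pretzel_rep k X"
    and "upper_triangular2 (X 1)" and "upper_triangular2 (longitude k X)"
    and "u = X 1 $ 1 $ 1" and "w = longitude k X $ 1 $ 1"
    and "t = tr_t X" and "\<sigma>\<^sub>1 = sigma1 (tr_s X)" and "l = tr_lambda X"
    and "character_in_X3 k X"
  shows "(1 + w) * (u + inverse u) * (\<sigma>\<^sub>1 + 2 - 2 * l)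
       = (1 - w) * (u - inverse u) * (\<sigma>\<^sub>1 + 2 - 2 * t^2)"
proof -
  define A B C where X: "A = X 1" "B = X 2" "C = X 3"
  have ix: "(1::3) + 1 = 2" "(2::3) + 1 = 3" "(3::3) + 1 = 1"
    "(1::3) - 1 = 3" "(2::3) - 1 = 1" "(3::3) - 1 = 2" by simp_all
  define Y1 Y2 Y3 where Y: "Y1 = B ** matrix_inv C" "Y2 = C ** matrix_inv A" "Y3 = A ** matrix_inv B"
  have YX: "Ymat X 1 = Y1" "Ymat X 2 = Y2" "Ymat X 3 = Y3"
    unfolding Ymat_def ix Y X by simp_all
  define s1 s2 s3 where s: "s1 = trace Y1" "s2 = trace Y2" "s3 = trace Y3"
  have sX: "tr_s X 1 = s1" "tr_s X 2 = s2" "tr_s X 3 = s3"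
    by (simp_all add: tr_s_def YX s)
  have d: "det A = 1" "det B = 1" "det C = 1"
    using assms(1) by (auto simp: pretzel_rep_def SL2C_def X)
  have dY: "det Y1 = 1" "det Y2 = 1" "det Y3 = 1"
    using d by (simp_all add: Y det_mul det_inv_SL2)
  have A12: "Amat k X 1 = Amat k X 2" and A23: "Amat k X 2 = Amat k X 3"
    using assms(1) by (auto simp: pretzel_rep_def)
  define T1 T2 T3 where T: "T1 = mat_powi Y1 (- k 1) ** mat_powi Y2 (k 2 + 1)"
    "T2 = mat_powi Y2 (- k 2) ** mat_powi Y3 (k 3 + 1)"
    "T3 = mat_powi Y3 (- k 3) ** mat_powi Y1 (k 1 + 1)"
  have AX: "Amat k X 1 = mat_powi Y1 (k 1) ** B ** mat_powi Y1 (- k 1) ** C"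
    "Amat k X 2 = mat_powi Y2 (k 2) ** C ** mat_powi Y2 (- k 2) ** A"
    "Amat k X 3 = mat_powi Y3 (k 3) ** A ** mat_powi Y3 (- k 3) ** B"
    unfolding Amat_def YX ix X by simp_all
  have T1: "B ** T1 = T1 ** A" unfolding T
    by (rule pretzel_intertwiner[OF d, folded Y]) (use A12 AX in simp)
  have T2: "C ** T2 = T2 ** B" unfolding T
    by (rule pretzel_intertwiner[OF d(2,3,1), folded Y]) (use A23 AX in simp)
  have T3: "A ** T3 = T3 ** C" unfolding T
    by (rule pretzel_intertwiner[OF d(3,1,2), folded Y]) (use A12 A23 AX in simp)
  have trA: "trace A = t" by (simp add: assms(6) tr_t_def X)
  have "trace A = trace B" "trace B = trace C"
    using T1 T2 dY by (auto intro!: trace_eq_of_intertwiner simp: T det_mul det_mat_powi)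
  hence tr: "trace A = t" "trace B = t" "trace C = t" using trA by simp_all
  note chr = assms(9)[unfolded character_in_X3_def Let_def, folded assms(6,7,8)]
  have t0: "t \<noteq> 0" and nz: "\<sigma>\<^sub>1 + 2 - 2 * l \<noteq> 0" using chr by auto
  have \<sigma>: "\<sigma>\<^sub>1 = s1 + s2 + s3" by (simp add: assms(7) sigma1_def sX)
  define a where "a = s1 + s2 + s3 + 2 - 2 * l"
  define F where "F = l^2 - (s1 + s2 + s3 + 2) * l + (s1 * s2 + s2 * s3 + s3 * s1 + 4)"
  define E where "E = a^2 + (l - 2 - s1) * (l - 2 - s2) * (l - 2 - s3)"
  have fricke: "t^2 * F = 4 + s1 * s2 * s3 + 2 * (s1 * s2 + s2 * s3 + s3 * s1) - (s1 + s2 + s3)^2"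
    using chr by (simp add: F_def \<sigma> delta_def sigma1_def sigma2_def sigma3_def sX)
  have om: "(l - 2 - tr_s X j) * omega (k j + 1) (tr_s X j) =
            (\<sigma>\<^sub>1 - tr_s X j - l) * omega (k j) (tr_s X j)" for j
    using chr by blast
  \<comment> \<open>Each pair \<open>(omega (k j) (s j), omega (k j + 1) (s j))\<close> is now determined up to a factor;
    the integers \<open>k j\<close> enter what follows only through these factors.\<close>
  obtain c1 where c1: "omega (k 1) s1 = c1 * (l - 2 - s1)" "omega (k 1 + 1) s1 = c1 * (s2 + s3 - l)"
    "c1^2 * ((t^2 - 2 - s1) * F) = -1"
    using omega_proportional[of l s1 "k 1" s2 s3 t] om[of 1] nz fricke
    unfolding sX \<sigma> F_def by blast
  have rot: "s2 + s3 + s1 = s1 + s2 + s3" "s3 + s1 + s2 = s1 + s2 + s3"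
    "s2 * s3 + s3 * s1 + s1 * s2 = s1 * s2 + s2 * s3 + s3 * s1"
    "s3 * s1 + s1 * s2 + s2 * s3 = s1 * s2 + s2 * s3 + s3 * s1"
    "s2 * s3 * s1 = s1 * s2 * s3" "s3 * s1 * s2 = s1 * s2 * s3"
    by simp_all
  obtain c2 where c2: "omega (k 2) s2 = c2 * (l - 2 - s2)" "omega (k 2 + 1) s2 = c2 * (s3 + s1 - l)"
    "c2^2 * ((t^2 - 2 - s2) * F) = -1"
    using omega_proportional[of l s2 "k 2" s3 s1 t] om[of 2] nz fricke
    unfolding sX \<sigma> F_def rot by blast
  obtain c3 where c3: "omega (k 3) s3 = c3 * (l - 2 - s3)" "omega (k 3 + 1) s3 = c3 * (s1 + s2 - l)"
    "c3^2 * ((t^2 - 2 - s3) * F) = -1"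
    using omega_proportional[of l s3 "k 3" s1 s2 t] om[of 3] nz fricke
    unfolding sX \<sigma> F_def rot by blast
  have h: "t^2 - 2 - s1 \<noteq> 0" "t^2 - 2 - s2 \<noteq> 0" "t^2 - 2 - s3 \<noteq> 0"
    using c1(3) c2(3) c3(3) by auto
  have A: "A$2$1 = 0" "A$1$1 = u" using assms(2,4) by (simp_all add: upper_triangular2_def X)
  define v where "v = inverse u"
  have "u * A$2$2 = 1" using d(1) A by (simp add: det_2)
  hence uv: "u * v = 1" "t = u + v"
    using tr(1) A unfolding v_def by (auto simp: trace2 inverse_unique)
  have r: "trace (A ** B ** C) = t^3 + t - l * t"
    using t0 by (simp add: assms(8) tr_lambda_def tr_tau_def tr_r_def X flip: assms(6))
  have r': "trace (B ** C ** A) = t^3 + t - l * t" "trace (C ** A ** B) = t^3 + t - l * t"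
    using r by (metis matrix_mul_assoc trace_mul_sym)+
  \<comment> \<open>\<open>a\<close>, \<open>F\<close> and \<open>E\<close> do not change when the indices are rotated.\<close>
  have rot2: "a = s2 + s3 + s1 + 2 - 2 * l"
    "F = l^2 - (s2 + s3 + s1 + 2) * l + (s2 * s3 + s3 * s1 + s1 * s2 + 4)"
    "E = a^2 + (l - 2 - s2) * (l - 2 - s3) * (l - 2 - s1)"
    unfolding rot a_def F_def E_def by (simp_all add: mult_ac)
  have rot3: "a = s3 + s1 + s2 + 2 - 2 * l"
    "F = l^2 - (s3 + s1 + s2 + 2) * l + (s3 * s1 + s1 * s2 + s2 * s3 + 4)"
    "E = a^2 + (l - 2 - s3) * (l - 2 - s1) * (l - 2 - s2)"
    unfolding rot a_def F_def E_def by (simp_all add: mult_ac)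
  obtain x1 y1 where g1: "T1 = (A + B - mat t) ** aff x1 y1 A"
    "(x1 * u + y1) * (t^2 - 2 - s3) = c1 * c2 * ((u - v) * E - v * a * F)"
    using pretzel_intertwiner_eigenvalue[OF d tr T1[unfolded T Y] s(1,2,3)[unfolded Y] r
        c1(1,2) c2(1,2) uv h(3) a_def F_def E_def]
    unfolding T Y by blast
  obtain x2 y2 where g2: "T2 = (B + C - mat t) ** aff x2 y2 B"
    "(x2 * u + y2) * (t^2 - 2 - s1) = c2 * c3 * ((u - v) * E - v * a * F)"
    using pretzel_intertwiner_eigenvalue[OF d(2,3,1) tr(2,3,1) T2[unfolded T Y]
        s(2,3,1)[unfolded Y] r'(1) c2(1,2) c3(1,2) uv h(1) rot2]
    unfolding T Y by blast
  obtain x3 y3 where g3: "T3 = (C + A - mat t) ** aff x3 y3 C"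
    "(x3 * u + y3) * (t^2 - 2 - s2) = c3 * c1 * ((u - v) * E - v * a * F)"
    using pretzel_intertwiner_eigenvalue[OF d(3,1,2) tr(3,1,2) T3[unfolded T Y]
        s(3,1,2)[unfolded Y] r'(2) c3(1,2) c1(1,2) uv h(2) rot3]
    unfolding T Y by blast
  have tr2: "trace (A ** B) = t^2 - s3" "trace (B ** C) = t^2 - s1" "trace (C ** A) = t^2 - s2"
    unfolding s Y using d tr by (simp_all add: trace_mult_inv power2_eq_square)
  have tr3: "trace (A ** C ** B) = t * (t^2 - 1 - (s1 + s2 + s3) + l)"
    using trace_product_sum[of A B C]
    unfolding r tr tr2 trace_mul_sym[of A C] by algebra
  have "longitude k X = T3 ** T2 ** T1"
    unfolding longitude_def YX T by (simp add: matrix_mul_assoc)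
  hence "w = (T3 ** T2 ** T1) $ 1 $ 1" by (simp add: assms(5))
  also have "\<dots> = (x1 * u + y1) * (x2 * u + y2) * (x3 * u + y3) *
    (trace (A ** C ** B) - v * (trace (A ** B) + trace (B ** C) + trace (C ** A))
    + 3 * t * v^2 - 2 * v^3)"
    unfolding g1(1) g2(1) g3(1) entry_of_intertwiner_product[OF d tr A]
      entry_of_sums[OF d(2,3) tr A uv] ..
  also have "\<dots> = (x1 * u + y1) * (x2 * u + y2) * (x3 * u + y3) *
    (t * (t^2 - 1 - (s1 + s2 + s3) + l) - v * (3 * t^2 - (s1 + s2 + s3)) + 3 * t * v^2 - 2 * v^3)"
    unfolding tr2 tr3 by algebra
  finally have w: "w = (x1 * u + y1) * (x2 * u + y2) * (x3 * u + y3) *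
    (t * (t^2 - 1 - (s1 + s2 + s3) + l) - v * (3 * t^2 - (s1 + s2 + s3)) + 3 * t * v^2 - 2 * v^3)" .
  have "(1 + w) * t * a = (1 - w) * (u - v) * (s1 + s2 + s3 + 2 - 2 * t^2)"
    unfolding a_def
    by (rule longitude_eigenvalue_relation[OF uv, of l s1 s2 s3 c1 c2 c3
        "x1 * u + y1" "x2 * u + y2" "x3 * u + y3"])
       (use fricke c1 c2 c3 g1 g2 g3 w in \<open>simp_all add: a_def F_def E_def\<close>)
  thus ?thesis using uv by (simp add: a_def \<sigma> v_def)
qed

end
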